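(* Let $\mathbf{F}$ be a bipartite Siegel modular form of genus 2 with trivial multiplier system, i.e. a $2\times2$ matrix of complex-valued functions on $\mathbb{H}_2$ satisfying $$\mathbf{F}(\Gamma\cdot M)=(CM+D)\,\mathbf{F}(M)\,(CM+D)^T$$ for all $\Gamma=\begin{pmatrix}A&B\\C&D\end{pmatrix}\in\mathrm{Sp}(4,\mathbb{Z})$ and all $M\in\mathbb{H}_2$. Then $\mathbf{F}(\sigma_i)=0$ for each of the six elliptic fixed points $\sigma_i$, $i=1,\dots,6$, of $\mathrm{Sp}(4,\mathbb{Z})$.
   Context: $\mathbb{H}_2=\{M\in \mathrm{Mat}(2\times2,\mathbb{C}) : M^T=M,\ \mathrm{Im}\,M>0\}$ is the Siegel upper half-space of genus 2. $\mathrm{Sp}(4,\mathbb{Z})$ is the group of integer $4\times4$ matrices $\Gamma=\begin{pmatrix}A&B\\C&D\end{pmatrix}$ ($2\times2$ blocks) with $\Gamma J\Gamma^T=J$, $J=\begin{pmatrix}0&I_2\\-I_2&0\end{pmatrix}$; it acts on $\mathbb{H}_2$ by $\Gamma\cdot M=(AM+B)(CM+D)^{-1}$. Put $\zeta=e^{2\pi i/5}$, $\eta=\tfrac13(1+2\sqrt2\,i)$, $\rho=e^{2\pi i/3}$. The elliptic fixed points are $$\sigma_1=\begin{pmatrix}\zeta&\zeta+\zeta^{-2}\\ \zeta+\zeta^{-2}&-\zeta^{-1}\end{pmatrix},\quad \sigma_2=\begin{pmatrix}\eta&\frac12(\eta-1)\\ \frac12(\eta-1)&\eta\end{pmatrix},\quad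 \sigma_3=\begin{pmatrix}i&0\\0&i\end{pmatrix},$$ $$\sigma_4=\begin{pmatrix}\rho&0\\0&\rho\end{pmatrix},\quad \sigma_5=\frac{i}{\sqrt3}\begin{pmatrix}2&1\\1&2\end{pmatrix},\quad \sigma_6=\begin{pmatrix}\rho&0\\0&i\end{pmatrix}.$$ *)

theory Defs
  imports "HOL-Analysis.Analysis"
begin

definition siegel_upper_half_space :: "(complex^2^2) set" where
  "siegel_upper_half_space =
     {M. transpose M = M \<and> (\<forall>v::real^2. v \<noteq> 0 \<longrightarrow> v \<bullet> (map_matrix Im M *v v) > 0)}"

text \<open>A \<open>4 \<times> 4\<close> matrix in \<open>2 \<times> 2\<close> blocks is indexed by the sum type \<open>2 + 2\<close>:
  \<open>Inl\<close> indexes the first two rows (columns), \<open>Inr\<close> the last two.\<close>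

type_synonym 'a block_matrix = "'a^(2 + 2)^(2 + 2)"

definition block_A :: "'a block_matrix \<Rightarrow> 'a^2^2" where
  "block_A G = (\<chi> i j. G $ Inl i $ Inl j)"

definition block_B :: "'a block_matrix \<Rightarrow> 'a^2^2" where
  "block_B G = (\<chi> i j. G $ Inl i $ Inr j)"

definition block_C :: "'a block_matrix \<Rightarrow> 'a^2^2" where
  "block_C G = (\<chi> i j. G $ Inr i $ Inl j)"

definition block_D :: "'a block_matrix \<Rightarrow> 'a^2^2" where
  "block_D G = (\<chi> i j. G $ Inr i $ Inr j)"

definition of_blocks :: "'a^2^2 \<Rightarrow> 'a^2^2 \<Rightarrow> 'a^2^2 \<Rightarrow> 'a^2^2 \<Rightarrow> 'a block_matrix" where
  "of_blocks A B C D = (\<chi> i j. case i of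
      Inl i' \<Rightarrow> (case j of Inl j' \<Rightarrow> A $ i' $ j' | Inr j' \<Rightarrow> B $ i' $ j')
    | Inr i' \<Rightarrow> (case j of Inl j' \<Rightarrow> C $ i' $ j' | Inr j' \<Rightarrow> D $ i' $ j'))"

definition symplectic_J :: "int block_matrix" where
  "symplectic_J = of_blocks 0 (mat 1) (- mat 1) 0"

definition Sp4Z :: "int block_matrix set" where
  "Sp4Z = {G. G ** symplectic_J ** transpose G = symplectic_J}"

definition automorphy_factor :: "int block_matrix \<Rightarrow> complex^2^2 \<Rightarrow> complex^2^2" where
  "automorphy_factor G M = map_matrix of_int (block_C G) ** M + map_matrix of_int (block_D G)"

definition siegel_action :: "int block_matrix \<Rightarrow> complex^2^2 \<Rightarrow> complex^2^2" where
  "siegel_action G M =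
     (map_matrix of_int (block_A G) ** M + map_matrix of_int (block_B G))
       ** matrix_inv (automorphy_factor G M)"

text \<open>The trivial multiplier system is built in. Functions are total in HOL, so the values of
  \<open>F\<close> outside the half-space are left unconstrained. No holomorphy and no symmetry of
  \<open>F M\<close> is required.\<close>

definition bipartite_siegel_form :: "(complex^2^2 \<Rightarrow> complex^2^2) \<Rightarrow> bool" where
  "bipartite_siegel_form F \<longleftrightarrow>
     (\<forall>G\<in>Sp4Z. \<forall>M\<in>siegel_upper_half_space.
        F (siegel_action G M) =
          automorphy_factor G M ** F M ** transpose (automorphy_factor G M))"

definition zeta5 :: complex where
  "zeta5 = exp (2 * of_real pi * \<i> / 5)"

definition eta :: complex where
  "eta = (1 / 3) * (1 + 2 * of_real (sqrt 2) * \<i>)"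

definition rho :: complex where
  "rho = exp (2 * of_real pi * \<i> / 3)"

definition sigma1 :: "complex^2^2" where
  "sigma1 = vector [vector [zeta5, zeta5 + zeta5 powi (-2)],
                    vector [zeta5 + zeta5 powi (-2), - (zeta5 powi (-1))]]"

definition sigma2 :: "complex^2^2" where
  "sigma2 = vector [vector [eta, (1 / 2) * (eta - 1)],
                    vector [(1 / 2) * (eta - 1), eta]]"

definition sigma3 :: "complex^2^2" where
  "sigma3 = vector [vector [\<i>, 0], vector [0, \<i>]]"

definition sigma4 :: "complex^2^2" where
  "sigma4 = vector [vector [rho, 0], vector [0, rho]]"

definition sigma5 :: "complex^2^2" where
  "sigma5 = map_matrix (\<lambda>x. \<i> / of_real (sqrt 3) * x) (vector [vector [2, 1], vector [1, 2]])"

definition sigma6 :: "complex^2^2" where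
  "sigma6 = vector [vector [rho, 0], vector [0, \<i>]]"

end

theory Submission
  imports Defs
begin

text \<open>If \<open>\<Gamma>\<close> fixes \<open>\<sigma>\<close>, then \<open>X = F \<sigma>\<close> satisfies \<open>J X J\<^sup>T = X\<close> with \<open>J = C \<sigma> + D\<close>. For \<open>\<lambda>\<close>, \<open>\<mu>\<close>
  the eigenvalues of \<open>J\<close>, the map \<open>X \<mapsto> J X J\<^sup>T\<close> has the eigenvalues \<open>\<lambda>\<^sup>2\<close>, \<open>\<lambda>\<mu>\<close> (twice) and \<open>\<mu>\<^sup>2\<close>,
  so \<open>X = 0\<close> as soon as \<open>\<lambda>\<mu> = det J \<noteq> 1\<close> and
  \<open>(1 - \<lambda>\<^sup>2) (1 - \<mu>\<^sup>2) = (1 + det J)\<^sup>2 - (tr J)\<^sup>2 \<noteq> 0\<close>. For each of the six points a single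
  \<open>\<Gamma>\<close> with this property exists, found by a search over \<open>C\<close>, \<open>D\<close> with
  entries in \<open>{-1, 0, 1}\<close>.\<close>

text \<open>Congruence by \<open>J\<close> scales the antisymmetric part of \<open>X\<close> by
  \<open>det J\<close> and acts on the symmetric part as the symmetric square of \<open>J\<close>;
  the two parts are killed in turn.\<close>

lemma congruence_fixed_imp_zero:
  fixes J X :: "'a::idom^2^2"
  assumes fixed: "J ** X ** transpose J = X"
    and det: "det J \<noteq> 1"
    and tr: "(trace J)\<^sup>2 \<noteq> (1 + det J)\<^sup>2"
  shows "X = 0"
proof -
  define a b c d where J: "a = J$1$1" "b = J$1$2" "c = J$2$1" "d = J$2$2"
  define x y z w where X: "x = X$1$1" "y = X$1$2" "z = X$2$1" "w = X$2$2"
  have "(J ** X ** transpose J)$i$j = X$i$j" for i j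
    using fixed by simp
  note eqs = this[of 1 1] this[of 1 2] this[of 2 1] this[of 2 2]
  have E: "a * (a * x + b * z) + b * (a * y + b * w) = x"
          "c * (a * x + b * z) + d * (a * y + b * w) = y"
          "a * (c * x + d * z) + b * (c * y + d * w) = z"
          "c * (c * x + d * z) + d * (c * y + d * w) = w"
    using eqs
    by (simp_all add: matrix_matrix_mult_def transpose_def sum_2 flip: J X)
       (simp_all add: algebra_simps)
  have D: "det J = a * d - b * c" and T: "trace J = a + d"
    by (simp_all add: det_2 trace_def sum_2 J)
  have nz: "a * d - b * c - 1 \<noteq> 0" "(1 + (a * d - b * c))\<^sup>2 - (a + d)\<^sup>2 \<noteq> 0"
    using det tr by (auto simp: D T)
  have "(a * d - b * c - 1) * (y - z) =
      (c * (a * x + b * z) + d * (a * y + b * w) - y) - (a * (c * x + d * z) + b * (c * y + d * w) - z)"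
    by (simp add: algebra_simps)
  then have "(a * d - b * c - 1) * (y - z) = 0"
    using E by simp
  then have yz: "y = z"
    using nz by simp
  \<comment> \<open>With \<open>y = z\<close>, these are the rows of the symmetric square minus the
    identity, applied to \<open>(x, y, w)\<close>. The determinant of that system is
    \<open>(\<lambda>\<^sup>2 - 1) (\<lambda>\<mu> - 1) (\<mu>\<^sup>2 - 1)\<close>, which is the
    \<open>\<delta>\<close> below.\<close>
  define R1 R2 R3 where
    R: "R1 = (a\<^sup>2 - 1) * x + 2 * a * b * y + b\<^sup>2 * w"
       "R2 = a * c * x + (a * d + b * c - 1) * y + b * d * w"
       "R3 = c\<^sup>2 * x + 2 * c * d * y + (d\<^sup>2 - 1) * w"
  have R0: "R1 = 0" "R2 = 0" "R3 = 0"
    using E(1,2,4) by (simp_all add: R yz power2_eq_square algebra_simps)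
  \<comment> \<open>Cramer's rule: the coefficients are the cofactors of this \<open>3 \<times> 3\<close> system.\<close>
  define \<delta> where "\<delta> = ((1 + (a * d - b * c))\<^sup>2 - (a + d)\<^sup>2) * (a * d - b * c - 1)"
  have "\<delta> * x = ((a * d + b * c - 1) * (d\<^sup>2 - 1) - 2 * b * c * d\<^sup>2) * R1
      - (2 * a * b * (d\<^sup>2 - 1) - 2 * b\<^sup>2 * c * d) * R2
      + (2 * a * b\<^sup>2 * d - b\<^sup>2 * (a * d + b * c - 1)) * R3"
    unfolding R \<delta>_def by algebra
  moreover have "\<delta> * y = (b * c\<^sup>2 * d - a * c * (d\<^sup>2 - 1)) * R1
      + ((a\<^sup>2 - 1) * (d\<^sup>2 - 1) - b\<^sup>2 * c\<^sup>2) * R2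
      - ((a\<^sup>2 - 1) * b * d - a * b\<^sup>2 * c) * R3"
    unfolding R \<delta>_def by algebra
  moreover have "\<delta> * w = (2 * a * c\<^sup>2 * d - (a * d + b * c - 1) * c\<^sup>2) * R1
      - (2 * (a\<^sup>2 - 1) * c * d - 2 * a * b * c\<^sup>2) * R2
      + ((a\<^sup>2 - 1) * (a * d + b * c - 1) - 2 * a\<^sup>2 * b * c) * R3"
    unfolding R \<delta>_def by algebra
  moreover have "\<delta> \<noteq> 0"
    using nz by (simp add: \<delta>_def)
  ultimately have "x = 0" "y = 0" "w = 0"
    using R0 by auto
  then show ?thesis
    using yz by (simp add: vec_eq_iff forall_2 flip: X)
qed

section \<open>Symplectic block matrices and the half-space\<close>

lemma block_of_blocks [simp]:
  "block_A (of_blocks A B C D) = A" "block_B (of_blocks A B C D) = B"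
  "block_C (of_blocks A B C D) = C" "block_D (of_blocks A B C D) = D"
  by (simp_all add: vec_eq_iff block_A_def block_B_def block_C_def block_D_def of_blocks_def)

lemma sum_UNIV_Plus:
  fixes f :: "'a::finite + 'b::finite \<Rightarrow> 'c::comm_monoid_add"
  shows "sum f UNIV = (\<Sum>i\<in>UNIV. f (Inl i)) + (\<Sum>i\<in>UNIV. f (Inr i))"
  by (simp add: sum.Plus o_def flip: UNIV_Plus_UNIV)

text \<open>The assumptions are the upper-left, lower-right and upper-right blocks of the symplectic
  relation; its lower-left block is minus the transpose of the upper-right one.\<close>

lemma of_blocks_in_Sp4Z:
  assumes "A ** transpose B = B ** transpose A" "C ** transpose D = D ** transpose C"
    and "A ** transpose D - B ** transpose C = mat 1"
  shows "of_blocks A B C D \<in> Sp4Z"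
  using assms
  unfolding Sp4Z_def symplectic_J_def
  by (simp add: vec_eq_iff matrix_matrix_mult_def transpose_def of_blocks_def sum_UNIV_Plus
      split_sum_all forall_2 sum_2 mat_def)
     (simp add: algebra_simps)

lemma mem_siegel_upper_half_spaceI:
  assumes sym: "M$2$1 = M$1$2"
    and pos: "Im (M$1$1) > 0" and det: "(Im (M$1$2))\<^sup>2 < Im (M$1$1) * Im (M$2$2)"
  shows "M \<in> siegel_upper_half_space"
proof -
  define a b c where abc: "a = Im (M$1$1)" "b = Im (M$1$2)" "c = Im (M$2$2)"
  have "v \<bullet> (map_matrix Im M *v v) > 0" if "v \<noteq> 0" for v :: "real^2"
  proof -
    define x y where xy: "x = v$1" "y = v$2"
    have "x \<noteq> 0 \<or> y \<noteq> 0"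
      using that by (auto simp: vec_eq_iff forall_2 xy)
    \<comment> \<open>Completing the square: this is the quadratic form multiplied by
      \<open>a > 0\<close>.\<close>
    then have "(a * x + b * y)\<^sup>2 + (a * c - b\<^sup>2) * y\<^sup>2 > 0"
      using pos det by (cases "y = 0") (auto simp: abc intro: add_nonneg_pos)
    also have "(a * x + b * y)\<^sup>2 + (a * c - b\<^sup>2) * y\<^sup>2 = a * (x * (a * x + b * y) + y * (b * x + c * y))"
      by (simp add: power2_eq_square algebra_simps)
    finally have "x * (a * x + b * y) + y * (b * x + c * y) > 0"
      using pos by (simp add: abc zero_less_mult_iff)
    then show ?thesis
      by (simp add: inner_vec_def matrix_vector_mult_def map_matrix_def sum_2 sym abc xy)
  qed
  then show ?thesis
    using sym by (simp add: siegel_upper_half_space_def vec_eq_iff forall_2 transpose_def)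
qed

text \<open>The fixed-point equation is multiplied by \<open>J\<close> on the right, so that no
  matrix inverse has to be computed at the individual points; \<open>det J \<noteq> 0\<close> gives
  the way back.\<close>

lemma bipartite_siegel_form_fixed_point:
  assumes F: "bipartite_siegel_form F" and M: "M \<in> siegel_upper_half_space"
    and G: "G \<in> Sp4Z" and J: "J = automorphy_factor G M"
    and fixed: "map_matrix of_int (block_A G) ** M + map_matrix of_int (block_B G) = M ** J"
    and det: "det J \<noteq> 0" "det J \<noteq> 1" and tr: "(trace J)\<^sup>2 \<noteq> (1 + det J)\<^sup>2"
  shows "F M = 0"
proof -
  have "J ** matrix_inv J = mat 1"
    \<comment> \<open>\<open>matrix_inv\<close> is a choice of two-sided inverse, so its property
      rests on the existence of one.\<close>
    using det(1) unfolding invertible_det_nz[symmetric] invertible_def matrix_inv_def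
    by (rule someI_ex[THEN conjunct1])
  then have "siegel_action G M = M"
    by (simp add: siegel_action_def fixed J flip: matrix_mul_assoc)
  then have "J ** F M ** transpose J = F M"
    using F M G by (metis J bipartite_siegel_form_def)
  then show ?thesis
    using det(2) tr by (rule congruence_fixed_imp_zero)
qed

section \<open>The points with explicit real and imaginary parts\<close>

lemma map_matrix_vector_2 [simp]:
  "map_matrix f (vector [vector [a, b], vector [c, d]] :: 'a::zero^2^2)
    = (vector [vector [f a, f b], vector [f c, f d]] :: 'b::zero^2^2)"
  by (simp add: vec_eq_iff forall_2 map_matrix_def)

lemmas matrix_2_simps = automorphy_factor_def vec_eq_iff forall_2 matrix_matrix_mult_def transpose_def
  sum_2 mat_def det_2 trace_def

text \<open>Here \<open>J\<close> has trace 0 and determinant -i.\<close>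

lemma bipartite_siegel_form_sigma3:
  assumes F: "bipartite_siegel_form F"
  shows "F sigma3 = 0"
proof (rule bipartite_siegel_form_fixed_point[OF F _ _ refl, where
      G = "of_blocks (vector [vector [0, 1], vector [0, 0]]) (vector [vector [0, 0], vector [-1, 0]])
                     (vector [vector [0, 0], vector [1, 0]]) (vector [vector [0, 1], vector [0, 0]])"])
  show "sigma3 \<in> siegel_upper_half_space"
    by (rule mem_siegel_upper_half_spaceI) (simp_all add: sigma3_def)
qed (auto intro!: of_blocks_in_Sp4Z simp: sigma3_def matrix_2_simps power2_eq_square complex_eq_iff)

lemma rho_eq: "rho = Complex (-1/2) (sqrt 3 / 2)"
  by (simp add: rho_def complex_eq_iff Re_exp Im_exp cos_120 sin_120)

text \<open>Here \<open>J\<close> has trace 0 and determinant \<open>- rho\<close>.\<close>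

lemma bipartite_siegel_form_sigma4:
  assumes F: "bipartite_siegel_form F"
  shows "F sigma4 = 0"
proof (rule bipartite_siegel_form_fixed_point[OF F _ _ refl, where
      G = "of_blocks (vector [vector [0, 1], vector [-1, 0]]) (vector [vector [0, 0], vector [-1, 0]])
                     (vector [vector [0, 0], vector [1, 0]]) (vector [vector [0, 1], vector [0, 0]])"])
  show "sigma4 \<in> siegel_upper_half_space"
    by (rule mem_siegel_upper_half_spaceI) (simp_all add: sigma4_def rho_eq)
qed (auto intro!: of_blocks_in_Sp4Z simp: sigma4_def rho_eq matrix_2_simps power2_eq_square complex_eq_iff)

text \<open>The matrix acts on the two diagonal entries separately: \<open>t\<close> goes to
  \<open>-1/(t + 1)\<close>, fixing \<open>rho\<close>, and to \<open>-1/t\<close>, fixing i. The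
  eigenvalues \<open>rho + 1\<close> and i of \<open>J\<close> have squares \<open>rho\<close> and
  -1.\<close>

lemma bipartite_siegel_form_sigma6:
  assumes F: "bipartite_siegel_form F"
  shows "F sigma6 = 0"
proof (rule bipartite_siegel_form_fixed_point[OF F _ _ refl, where
      G = "of_blocks (vector [vector [0, 0], vector [0, 0]]) (vector [vector [-1, 0], vector [0, -1]])
                     (vector [vector [1, 0], vector [0, 1]]) (vector [vector [1, 0], vector [0, 0]])"])
  show "sigma6 \<in> siegel_upper_half_space"
    by (rule mem_siegel_upper_half_spaceI) (simp_all add: sigma6_def rho_eq)
qed (auto intro!: of_blocks_in_Sp4Z simp: sigma6_def rho_eq matrix_2_simps power2_eq_square complex_eq_iff)

text \<open>Here \<open>det J = -1\<close>, while the trace has square -3.\<close>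

lemma bipartite_siegel_form_sigma5:
  assumes F: "bipartite_siegel_form F"
  shows "F sigma5 = 0"
proof (rule bipartite_siegel_form_fixed_point[OF F _ _ refl, where
      G = "of_blocks (vector [vector [0, 0], vector [0, 0]]) (vector [vector [-1, -1], vector [0, -1]])
                     (vector [vector [1, 0], vector [-1, 1]]) (vector [vector [0, 0], vector [0, 0]])"])
  show "sigma5 \<in> siegel_upper_half_space"
    by (rule mem_siegel_upper_half_spaceI)
       (simp_all add: sigma5_def Im_divide power2_eq_square field_simps)
qed (auto intro!: of_blocks_in_Sp4Z
      simp: sigma5_def matrix_2_simps power2_eq_square complex_eq_iff Re_divide Im_divide field_simps)

text \<open>Again \<open>det J = -1\<close>; the trace now has square -2.\<close>

lemma bipartite_siegel_form_sigma2:
  assumes F: "bipartite_siegel_form F"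
  shows "F sigma2 = 0"
proof -
  have sqrt2: "sqrt 2 * (sqrt 2 * x) = 2 * x" for x
    by (simp flip: mult.assoc)
  show ?thesis
  proof (rule bipartite_siegel_form_fixed_point[OF F _ _ refl, where
        G = "of_blocks (vector [vector [1, -1], vector [-1, 0]]) (vector [vector [-1, 0], vector [0, -1]])
                       (vector [vector [1, 0], vector [-1, 1]]) (vector [vector [0, 0], vector [0, -1]])"])
    show "sigma2 \<in> siegel_upper_half_space"
      by (rule mem_siegel_upper_half_spaceI)
         (simp_all add: sigma2_def eta_def power2_eq_square field_simps)
  qed (auto intro!: of_blocks_in_Sp4Z
        simp: sqrt2 sigma2_def eta_def matrix_2_simps power2_eq_square complex_eq_iff field_simps)
qed

section \<open>The point built from the fifth root of unity\<close>

lemma zeta5_cis: "zeta5 = cis (2 * pi / 5)"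
  by (simp add: zeta5_def cis_conv_exp mult_ac)

lemma zeta5_power5: "zeta5 ^ 5 = 1"
  by (simp add: zeta5_cis Complex.DeMoivre)

lemma cos_2pi_5: "0 < cos (2 * pi / 5)" "cos (2 * pi / 5) < 1"
  using cos_monotone_0_pi[of 0 "2 * pi / 5"] pi_gt_zero by (auto intro!: cos_gt_zero)

lemma sin_2pi_5: "sin (2 * pi / 5) > 0"
  by (rule sin_gt_zero) auto

text \<open>Once negative powers of \<open>zeta5\<close> are replaced by positive ones, the
  conditions on \<open>J\<close> are polynomial and follow from the cyclotomic relation
  \<open>cyc\<close>; only membership in the half-space needs trigonometry.\<close>

lemma bipartite_siegel_form_sigma1:
  assumes F: "bipartite_siegel_form F"
  shows "F sigma1 = 0"
proof -
  let ?z = zeta5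
  let ?G = "of_blocks (vector [vector [0, 1], vector [0, 0]]) (vector [vector [1, 1], vector [1, 0]])
                      (vector [vector [0, 0], vector [-1, 0]]) (vector [vector [0, 1], vector [0, -1]])"
  have ne1: "?z \<noteq> 1"
    using sin_2pi_5 by (auto simp: zeta5_cis complex_eq_iff)
  have ne0: "?z \<noteq> 0"
    by (simp add: zeta5_cis)
  have "(?z - 1) * (1 + ?z + ?z^2 + ?z^3 + ?z^4) = 0"
    using zeta5_power5 by algebra
  with ne1 have cyc: "1 + ?z + ?z^2 + ?z^3 + ?z^4 = 0"
    by simp
  have "?z * ?z^4 = 1"
    using zeta5_power5 by algebra
  then have inv: "inverse ?z = ?z^4"
    by (rule inverse_unique)
  have "?z powi (-2) = inverse ?z ^ 2"
    by (simp add: power_int_def)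
  also have "\<dots> = ?z^3"
    unfolding inv using zeta5_power5 by algebra
  finally have sigma1: "sigma1 = vector [vector [?z, ?z + ?z^3], vector [?z + ?z^3, - (?z^4)]]"
    by (simp add: sigma1_def inv)
  show ?thesis
  proof (rule bipartite_siegel_form_fixed_point[OF F _ _ refl, where G = ?G])
    have z4: "?z^4 = cnj ?z"
      unfolding inv[symmetric] by (simp add: zeta5_cis cis_cnj)
    have "?z^3 = (?z^4)^2"
      using zeta5_power5 by algebra
    then have z3: "?z^3 = (cnj ?z)^2"
      by (simp only: z4)
    show "sigma1 \<in> siegel_upper_half_space"
    proof (rule mem_siegel_upper_half_spaceI)
      let ?c = "cos (2 * pi / 5)" and ?s = "sin (2 * pi / 5)"
      \<comment> \<open>Both diagonal entries have imaginary part \<open>?s\<close>, and the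
        off-diagonal one has \<open>?s * (1 - 2 * ?c)\<close> by the double-angle formula.\<close>
      have "\<bar>1 - 2 * ?c\<bar> < 1"
        using cos_2pi_5 by linarith
      then have "(1 - 2 * ?c)\<^sup>2 < 1"
        by (simp add: abs_square_less_1)
      then have "?s\<^sup>2 * (1 - 2 * ?c)\<^sup>2 < ?s\<^sup>2 * 1"
        using sin_2pi_5 by (intro mult_strict_left_mono) auto
      then show "(Im (sigma1$1$2))\<^sup>2 < Im (sigma1$1$1) * Im (sigma1$2$2)"
        unfolding sigma1 vector_2 z3 z4 by (simp add: zeta5_cis power2_eq_square algebra_simps)
    qed (use sin_2pi_5 z4 in \<open>simp_all add: sigma1 zeta5_cis\<close>)
  next
    have J: "automorphy_factor ?G sigma1 =
        vector [vector [0, 1], vector [- ?z, - 1 - ?z - ?z^3]]"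
      by (simp add: sigma1 matrix_2_simps)
    then have det: "det (automorphy_factor ?G sigma1) = ?z"
      and tr: "trace (automorphy_factor ?G sigma1) = - 1 - ?z - ?z^3"
      by (simp_all add: det_2 trace_def sum_2)
    show "det (automorphy_factor ?G sigma1) \<noteq> 0" "det (automorphy_factor ?G sigma1) \<noteq> 1"
      using ne0 ne1 by (simp_all add: det)
    show "(trace (automorphy_factor ?G sigma1))\<^sup>2 \<noteq> (1 + det (automorphy_factor ?G sigma1))\<^sup>2"
    proof
      assume "(trace (automorphy_factor ?G sigma1))\<^sup>2 = (1 + det (automorphy_factor ?G sigma1))\<^sup>2"
      \<comment> \<open>The assumed equality reads \<open>?z^3 * (?z^3 + 2 * ?z + 2) = 0\<close>;
        eliminating \<open>?z\<close> between it and \<open>cyc\<close> leaves the constant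
        5.\<close>
      with cyc have "(5::complex) = 0"
        unfolding det tr by algebra
      then show False
        by simp
    qed
    show "map_matrix of_int (block_A ?G) ** sigma1 + map_matrix of_int (block_B ?G)
        = sigma1 ** automorphy_factor ?G sigma1"
      unfolding J using cyc
      by (simp add: sigma1 vec_eq_iff forall_2 matrix_matrix_mult_def sum_2) algebra
  qed (auto intro!: of_blocks_in_Sp4Z simp: matrix_2_simps)
qed

theorem theorem4p2:
  fixes F :: "complex^2^2 \<Rightarrow> complex^2^2"
  assumes "bipartite_siegel_form F"
  shows "\<forall>\<sigma>\<in>{sigma1, sigma2, sigma3, sigma4, sigma5, sigma6}. F \<sigma> = 0"
  using assms
  by (simp add: bipartite_siegel_form_sigma1 bipartite_siegel_form_sigma2
      bipartite_siegel_form_sigma3 bipartite_siegel_form_sigma4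
      bipartite_siegel_form_sigma5 bipartite_siegel_form_sigma6)

end
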